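(* Let $C$ be a finite cyclic group of order $n$ and let $S$ be a finite left $C$-set. For each positive integer $d$ let $a_d$ be the number of $C$-orbits in $S$ of cardinality $d$. If $m$ is a divisor of $n$, then $$a_m=\sum_{d\mid \frac{n}{m}}\mu(d)\,N_{md},$$ where $\mu$ is the Möbius function and the integers $N_k$ (for $k\mid n$) are as defined in the context.
   Context: For a divisor $k$ of $n$, $C^k=\{c^k: c\in C\}$ is the subgroup of $C$ of index $k$, and $M_k=|C^k\backslash S|$ is the number of $C^k$-orbits in $S$. $\Omega$ is the prime omega function counting prime divisors of a positive integer with multiplicity. For a divisor $k$ of $n$, let $T=T(k)$ be the divisor of $k$ such that $k/T$ is the maximal square-free divisor of $k$ (i.e. $k/T$ is the product of the distinct primes dividing $k$), and set $$N_k=\frac{1}{T}\cdot\frac{\sum_{T\mid d\mid k}(-1)^{\Omega(kd)}M_d}{\prod_{q\mid \frac{k}{T},\ q\text{ prime}}(q-1)},$$ where the sum runs over all positive integers $d$ with $T\mid d$ and $d\mid k$. *)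

theory Defs
  imports Complex_Main "HOL-Algebra.Elementary_Groups" "HOL-Algebra.Group_Action"
    "HOL-Computational_Algebra.Squarefree"
begin

definition moebius_mu :: "nat \<Rightarrow> int" where
  "moebius_mu n = (if squarefree n then (- 1) ^ card (prime_factors n) else 0)"

definition big_omega :: "nat \<Rightarrow> nat" where
  "big_omega n = size (prime_factorization n)"

(* The divisor T(k) of k for which k / T(k) is the maximal square-free divisor of k;
   the next two lemmas confirm this characterization. *)
definition sqfree_cofactor :: "nat \<Rightarrow> nat" where
  "sqfree_cofactor k = k div (\<Prod>q\<in>prime_factors k. q)"

lemma sqfree_cofactor_dvd:
  assumes "k > 0"
  shows "sqfree_cofactor k dvd k"
    and "k div sqfree_cofactor k = (\<Prod>q\<in>prime_factors k. q)"
proof -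
  have "(\<Prod>q\<in>prime_factors k. q) dvd (\<Prod>q\<in>prime_factors k. q ^ multiplicity q k)"
    by (intro prod_dvd_prod dvd_power) (auto simp: prime_factors_multiplicity)
  also have "\<dots> = k"
    using assms by (simp add: prime_factorization_nat [symmetric])
  finally have dvd: "(\<Prod>q\<in>prime_factors k. q) dvd k" .
  then obtain t where t: "k = (\<Prod>q\<in>prime_factors k. q) * t" by (rule dvdE)
  define r where "r = (\<Prod>q\<in>prime_factors k. q)"
  have kt: "k = r * t" using t by (simp add: r_def)
  have pos: "r > 0" "t > 0" using kt assms by (auto intro: Nat.gr0I)
  have T: "sqfree_cofactor k = t"
    unfolding sqfree_cofactor_def r_def [symmetric] using pos kt
    by (metis nonzero_mult_div_cancel_left less_numeral_extra(3))
  show "sqfree_cofactor k dvd k" using T kt by simp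
  show "k div sqfree_cofactor k = (\<Prod>q\<in>prime_factors k. q)"
    unfolding T r_def [symmetric] using pos kt by (metis nonzero_mult_div_cancel_right less_numeral_extra(3))
qed

lemma squarefree_dvd_sqfree_part_iff:
  assumes "k > 0"
  shows "squarefree d \<and> d dvd k \<longleftrightarrow> d dvd k div sqfree_cofactor k"
proof -
  define r where "r = (\<Prod>q\<in>prime_factors k. q)"
  have r: "k div sqfree_cofactor k = r"
    using sqfree_cofactor_dvd(2) [OF assms] by (simp only: r_def)
  have rk: "r dvd k"
    using sqfree_cofactor_dvd(1) [OF assms] r by (metis dvd_div_mult_self dvd_triv_left)
  have sq: "squarefree r"
    unfolding r_def
    by (intro squarefree_prod_coprime)
       (auto intro: primes_coprime squarefree_prime)
  have "d dvd r" if "squarefree d" "d dvd k"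
  proof -
    have d0: "d > 0" using that assms by (auto intro: Nat.gr0I)
    have "d = (\<Prod>q\<in>prime_factors d. q ^ multiplicity q d)"
      using d0 by (simp add: prime_factorization_nat [symmetric])
    also have "\<dots> = (\<Prod>q\<in>prime_factors d. q)"
      using that(1) d0 by (intro prod.cong refl)
        (auto simp: squarefree_factorial_semiring' prime_factors_multiplicity)
    also have "\<dots> dvd r"
      unfolding r_def using that(2) assms
      by (intro prod_dvd_prod_subset) (auto simp: prime_factors_dvd intro: dvd_trans)
    finally show ?thesis .
  qed
  moreover have "squarefree d \<and> d dvd k" if "d dvd r"
    using that sq rk squarefree_mono dvd_trans by blast
  ultimately show ?thesis unfolding r by blast
qed

definition power_subgroup :: "('a, 'm) monoid_scheme \<Rightarrow> nat \<Rightarrow> ('a, 'm) monoid_scheme" where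
  "power_subgroup C k = C\<lparr>carrier := {c [^]\<^bsub>C\<^esub> k | c. c \<in> carrier C}\<rparr>"

definition num_orbits_power ::
    "('a, 'm) monoid_scheme \<Rightarrow> 'b set \<Rightarrow> ('a \<Rightarrow> 'b \<Rightarrow> 'b) \<Rightarrow> nat \<Rightarrow> nat" where
  "num_orbits_power C S \<phi> k = card (orbits (power_subgroup C k) S \<phi>)"

definition num_orbits_of_size ::
    "('a, 'm) monoid_scheme \<Rightarrow> 'b set \<Rightarrow> ('a \<Rightarrow> 'b \<Rightarrow> 'b) \<Rightarrow> nat \<Rightarrow> nat" where
  "num_orbits_of_size C S \<phi> d = card {X \<in> orbits C S \<phi>. card X = d}"

(* The values turn out to be integers, but the defining quotients are formed in the rationals. *)
definition orbit_N ::
    "('a, 'm) monoid_scheme \<Rightarrow> 'b set \<Rightarrow> ('a \<Rightarrow> 'b \<Rightarrow> 'b) \<Rightarrow> nat \<Rightarrow> rat" where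
  "orbit_N C S \<phi> k = (let T = sqfree_cofactor k in
     1 / of_nat T *
     ((\<Sum>d | T dvd d \<and> d dvd k. (- 1) ^ big_omega (k * d) * of_nat (num_orbits_power C S \<phi> d))
      / (\<Prod>q | prime q \<and> q dvd k div T. (of_nat q - 1))))"

end

theory Submission
  imports Defs "HOL-Number_Theory.Totient"
begin

text \<open>
  The point is to see what \<open>N\<^sub>k\<close> counts: it is the number of \<open>C\<close>-orbits whose size is divisible
  by \<open>k\<close> (\<open>orbit_N_eq_card\<close>). Integrality is then evident, and the formula for \<open>a\<^sub>m\<close> is Moebius
  inversion over the divisors of \<open>n / m\<close>, since every orbit size divides \<open>n\<close>.

  To identify \<open>N\<^sub>k\<close>, let \<open>X\<close> be a \<open>C\<close>-orbit with \<open>j\<close> elements. A generator of \<open>C\<close> permutes \<open>X\<close> as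
  a single cycle of length \<open>j\<close>, so that \<open>X\<close> looks like the integers modulo \<open>j\<close> and \<open>C\<^sup>d\<close> acts by
  translations by multiples of \<open>d\<close>; the number of \<open>C\<^sup>d\<close>-orbits in \<open>X\<close> is therefore \<open>gcd d j\<close>
  (\<open>card_power_orbits_in_orbit\<close>), and \<open>M\<^sub>d\<close> is the sum of these numbers over all \<open>X\<close>.

  The signed sum defining \<open>N\<^sub>k\<close> is a Moebius sum in disguise. A divisor \<open>d\<close> of \<open>k\<close> is a multiple of
  \<open>T(k)\<close> exactly if \<open>k / d\<close> is squarefree, and in that case \<open>(-1)\<close> to the power \<open>\<Omega>(k d)\<close> is
  \<open>\<mu>(k / d)\<close>. Hence an orbit of size \<open>j\<close> contributes the sum of \<open>\<mu>(k / d) gcd d j\<close> over all \<open>d\<close>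
  dividing \<open>k\<close>. As \<open>gcd d j\<close> is the sum of Euler's \<open>totient e\<close> over the common divisors \<open>e\<close> of \<open>d\<close>
  and \<open>j\<close>, inversion gives \<open>totient k\<close> if \<open>k\<close> divides \<open>j\<close> and \<open>0\<close> otherwise (\<open>sum_moebius_mu_gcd\<close>).
  The normalising factor in \<open>N\<^sub>k\<close> is exactly \<open>1 / totient k\<close> (\<open>totient_sqfree_cofactor\<close>), so each orbit
  whose size is a multiple of \<open>k\<close> is counted once and the others not at all.
\<close>

section \<open>Moebius inversion and the arithmetic of the sign\<close>

lemma prime_factorization_squarefree:
  fixes d :: nat
  assumes "squarefree d"
  shows "prime_factorization d = mset_set (prime_factors d)"
proof (rule multiset_eqI)
  fix p
  have d0: "d \<noteq> 0" using assms by (metis not_squarefree_0)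
  show "count (prime_factorization d) p = count (mset_set (prime_factors d)) p"
  proof (cases "p \<in> prime_factors d")
    case True
    then have "multiplicity p d = 1" "prime p"
      using assms d0 squarefree_factorial_semiring' by blast+
    with True show ?thesis by (simp add: count_prime_factorization)
  next
    case False
    then show ?thesis by (simp add: not_in_iff)
  qed
qed

lemma prime_factors_prod_primes:
  fixes X :: "nat set"
  assumes "finite X" and "\<And>p. p \<in> X \<Longrightarrow> prime p"
  shows "prime_factors (\<Prod>X) = X"
proof -
  have "\<Prod>X = prod_mset (mset_set X)"
    by (simp add: prod_unfold_prod_mset)
  then have "prime_factorization (\<Prod>X) = mset_set X"
    using prime_factorization_prod_mset_primes [of "mset_set X"] assms by simp
  then show ?thesis using assms by simp
qed

text \<open>
  Only squarefree divisors contribute, and these correspond to the subsets of the set \<open>P\<close> of prime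
  factors of \<open>n\<close>. The alternating sum over these subsets is the expansion of the product of \<open>1 - 1\<close>
  over \<open>P\<close>, which vanishes unless \<open>P\<close> is empty.
\<close>
lemma sum_moebius_mu_divisors:
  assumes "n > 0"
  shows "(\<Sum>d | d dvd n. moebius_mu d) = (if n = 1 then 1 else 0)"
proof -
  let ?P = "prime_factors n"
  have "(\<Sum>d | d dvd n. moebius_mu d) = (\<Sum>d | d dvd n \<and> squarefree d. (- 1) ^ card (prime_factors d))"
    using assms by (intro sum.mono_neutral_cong_right) (auto simp: moebius_mu_def)
  also have "\<dots> = (\<Sum>X\<in>Pow ?P. (- 1) ^ card X)"
  proof (rule sum.reindex_bij_witness [where i = "\<lambda>X. \<Prod>X" and j = prime_factors])
    fix d assume d: "d \<in> {d. d dvd n \<and> squarefree d}"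
    then have d0: "d \<noteq> 0" by (auto intro: ccontr)
    have "prod_mset (prime_factorization d) = d"
      using d0 by (simp add: prod_mset_prime_factorization_nat)
    moreover have "prod_mset (mset_set (prime_factors d)) = \<Prod>(prime_factors d)"
      by (simp add: prod_unfold_prod_mset)
    ultimately show "\<Prod>(prime_factors d) = d"
      using prime_factorization_squarefree [of d] d by simp
    show "prime_factors d \<in> Pow ?P"
      using d assms by (auto simp: dvd_prime_factors)
  next
    fix X assume X: "X \<in> Pow ?P"
    then have X': "finite X" "\<And>p. p \<in> X \<Longrightarrow> prime p"
      by (auto intro: finite_subset [of _ ?P] in_prime_factors_imp_prime)
    show "prime_factors (\<Prod>X) = X"
      by (rule prime_factors_prod_primes) (use X' in auto)
    have "\<Prod>X dvd \<Prod>?P"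
      using X by (intro prod_dvd_prod_subset) auto
    also have "\<dots> = n div sqfree_cofactor n"
      using sqfree_cofactor_dvd(2) [OF assms] by simp
    finally show "\<Prod>X \<in> {d. d dvd n \<and> squarefree d}"
      using squarefree_dvd_sqfree_part_iff [OF assms] by auto
  qed simp
  also have "\<dots> = (\<Prod>p\<in>?P. (1 :: int) - 1)"
    by (subst prod_diff_conv_sum) simp_all
  also have "\<dots> = (if n = 1 then 1 else 0)"
    using assms prime_factorization_empty_iff [of n] by (auto simp: card_gt_0_iff)
  finally show ?thesis .
qed

text \<open>
  The contribution of one orbit of size \<open>j\<close> to the final inversion. If \<open>j = m c\<close>, the condition
  \<open>m d dvd j\<close> says \<open>d dvd c\<close>, and all divisors of \<open>c\<close> occur in the range of summation because
  \<open>j\<close> divides \<open>n\<close>; what remains is the sum of \<open>\<mu>\<close> over the divisors of \<open>c\<close>.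
\<close>
lemma sum_moebius_mu_dvd_both:
  assumes "j > 0" and "j dvd n" and "n > 0" and "m dvd n"
  shows "(\<Sum>d | d dvd n div m. if m * d dvd j then moebius_mu d else 0) = (if j = m then 1 else 0)"
proof (cases "m dvd j")
  case True
  then obtain c where c: "j = m * c" by (rule dvdE)
  with assms have pos: "m > 0" "c > 0" by auto
  have "c dvd n div m"
    using assms c pos by (metis div_mult_mult1 dvd_div_iff_mult mult.commute neq0_conv)
  moreover have "n div m > 0" using assms(3,4) by (metis dvd_div_eq_0_iff neq0_conv)
  ultimately have "(\<Sum>d | d dvd n div m. if m * d dvd j then moebius_mu d else 0)
      = (\<Sum>d | d dvd c. moebius_mu d)"
    using c pos by (intro sum.mono_neutral_cong_right) (auto intro: dvd_trans)
  also have "\<dots> = (if j = m then 1 else 0)"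
    using pos c by (simp add: sum_moebius_mu_divisors)
  finally show ?thesis .
next
  case False
  then show ?thesis by (auto intro!: sum.neutral dest: dvd_mult_left)
qed

text \<open>
  The involution \<open>d \<mapsto> k / d\<close> carries the interval from \<open>e\<close> to \<open>k\<close> of the divisor lattice to the
  divisors of \<open>k / e\<close>.
\<close>
lemma sum_moebius_mu_cofactor:
  assumes "k > 0" and "e dvd k"
  shows "(\<Sum>d | e dvd d \<and> d dvd k. moebius_mu (k div d)) = (if e = k then 1 else 0)"
proof -
  from assms obtain c where c: "k = e * c" by (auto elim: dvdE)
  with assms have pos: "e > 0" "c > 0" by auto
  have "(\<Sum>d | e dvd d \<and> d dvd k. moebius_mu (k div d)) = (\<Sum>d | d dvd c. moebius_mu d)"
  proof (rule sum.reindex_bij_witness [where i = "\<lambda>d. k div d" and j = "\<lambda>d. k div d"])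
    fix d assume "d \<in> {d. e dvd d \<and> d dvd k}"
    then obtain a b where ab: "d = e * a" "k = d * b" by (auto elim!: dvdE)
    with assms have d: "d > 0" "b > 0" by auto
    show "k div (k div d) = d" using ab d by simp
    have "c = a * b" using ab c pos by simp
    then show "k div d \<in> {d. d dvd c}" using ab d by simp
  next
    fix d assume "d \<in> {d. d dvd c}"
    then obtain b where b: "c = d * b" by (auto elim!: dvdE)
    with pos have d: "d > 0" "b > 0" by auto
    have kd: "k div d = e * b" using b c d by simp
    show "k div (k div d) = d" unfolding kd using b c d pos by simp
    show "k div d \<in> {d. e dvd d \<and> d dvd k}" unfolding kd using b c by simp
  qed simp
  also have "\<dots> = (if e = k then 1 else 0)"
    using pos c by (simp add: sum_moebius_mu_divisors)
  finally show ?thesis .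
qed

text \<open>
  By Gauss's identity \<open>gcd d j\<close> is the sum of \<open>totient e\<close> over the common divisors \<open>e\<close> of \<open>d\<close> and \<open>j\<close>.
  After exchanging the sums, the inner sum over the multiples \<open>d\<close> of \<open>e\<close> kills every term except
  \<open>e = k\<close>.
\<close>
lemma sum_moebius_mu_gcd:
  assumes "k > 0"
  shows "(\<Sum>d | d dvd k. moebius_mu (k div d) * int (gcd d j)) = (if k dvd j then int (totient k) else 0)"
proof -
  let ?D = "{d. d dvd k}"
  have fin: "finite ?D" using assms by simp
  \<comment> \<open>Extending the range to all divisors \<open>e\<close> of \<open>k\<close> makes it independent of \<open>d\<close>.\<close>
  have gcd: "int (gcd d j) = (\<Sum>e | e dvd k. if e dvd d \<and> e dvd j then int (totient e) else 0)"
    if "d dvd k" for d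
  proof -
    have "int (gcd d j) = (\<Sum>e | e dvd gcd d j. int (totient e))"
      using totient_divisor_sum [of "gcd d j"] by (metis of_nat_sum)
    also have "\<dots> = (\<Sum>e | e dvd k. if e dvd d \<and> e dvd j then int (totient e) else 0)"
      using that fin by (intro sum.mono_neutral_cong_left) (auto intro: dvd_trans)
    finally show ?thesis .
  qed
  have "(\<Sum>d\<in>?D. moebius_mu (k div d) * int (gcd d j))
      = (\<Sum>d\<in>?D. \<Sum>e\<in>?D. if e dvd d \<and> e dvd j then moebius_mu (k div d) * int (totient e) else 0)"
    by (intro sum.cong refl) (auto simp: gcd sum_distrib_left intro!: sum.cong)
  also have "\<dots> = (\<Sum>e\<in>?D. \<Sum>d\<in>?D. if e dvd d \<and> e dvd j then moebius_mu (k div d) * int (totient e) else 0)"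
    by (rule sum.swap)
  also have "\<dots> = (\<Sum>e\<in>?D. if e = k then (if k dvd j then int (totient k) else 0) else 0)"
  proof (intro sum.cong refl)
    fix e assume e: "e \<in> ?D"
    have "(\<Sum>d\<in>?D. if e dvd d \<and> e dvd j then moebius_mu (k div d) * int (totient e) else 0)
        = (\<Sum>d | e dvd d \<and> d dvd k. if e dvd j then moebius_mu (k div d) * int (totient e) else 0)"
      using fin by (intro sum.mono_neutral_cong_right) auto
    also have "\<dots> = (if e dvd j then (\<Sum>d | e dvd d \<and> d dvd k. moebius_mu (k div d)) * int (totient e) else 0)"
      by (simp add: sum_distrib_right)
    finally show "(\<Sum>d\<in>?D. if e dvd d \<and> e dvd j then moebius_mu (k div d) * int (totient e) else 0)
        = (if e = k then (if k dvd j then int (totient k) else 0) else 0)"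
      using e assms by (simp add: sum_moebius_mu_cofactor)
  qed
  also have "\<dots> = (if k dvd j then int (totient k) else 0)"
    using fin by (simp add: sum.delta)
  finally show ?thesis .
qed

text \<open>
  Write \<open>k = T r = d e\<close> with \<open>r\<close> the largest squarefree divisor of \<open>k\<close>. Then \<open>e\<close> is squarefree
  iff it divides \<open>r\<close>, and passing to complementary divisors this means that \<open>T\<close> divides \<open>d\<close>.
\<close>
lemma sqfree_cofactor_dvd_iff:
  assumes "k > 0" and "d dvd k"
  shows "sqfree_cofactor k dvd d \<longleftrightarrow> squarefree (k div d)"
proof -
  define T where "T = sqfree_cofactor k"
  from assms obtain e where e: "k = d * e" by (auto elim: dvdE)
  obtain r where r: "k = T * r"
    using sqfree_cofactor_dvd(1) [OF assms(1)] by (auto simp: T_def elim: dvdE)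
  have "d * e > 0" "T * r > 0" using assms(1) e r by metis+
  then have pos: "d > 0" "e > 0" "T > 0" "r > 0" by simp_all
  have "squarefree e \<longleftrightarrow> e dvd r"
    using squarefree_dvd_sqfree_part_iff [OF assms(1), of e] e r pos
    by (metis T_def dvd_triv_right nonzero_mult_div_cancel_left neq0_conv)
  also have "\<dots> \<longleftrightarrow> T dvd d"
  proof
    assume "e dvd r"
    then obtain c where "r = e * c" by (rule dvdE)
    with e r pos have "d * e = T * c * e" by (simp add: ac_simps)
    with pos have "d = T * c" by simp
    then show "T dvd d" by simp
  next
    assume "T dvd d"
    then obtain c where "d = T * c" by (rule dvdE)
    with e r pos have "T * r = T * (c * e)" by (simp add: ac_simps)
    with pos have "r = c * e" by simp
    then show "e dvd r" by simp
  qed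
  finally show ?thesis using e pos by (simp add: T_def)
qed

text \<open>
  With \<open>k = d e\<close>, complete additivity gives \<open>\<Omega>(k d) = 2 \<Omega>(d) + \<Omega>(e)\<close>, so only the parity of
  \<open>\<Omega>(e)\<close> matters, and for squarefree \<open>e\<close> this is the number of prime factors.
\<close>
lemma sign_big_omega_eq_moebius_mu:
  assumes "k > 0" and "d dvd k" and "squarefree (k div d)"
  shows "(- 1) ^ big_omega (k * d) = moebius_mu (k div d)"
proof -
  from assms obtain e where e: "k = d * e" by (auto elim: dvdE)
  have pos: "d > 0" "e > 0" using e assms by auto
  have sq: "squarefree e" using assms e pos by simp
  have "big_omega (k * d) = 2 * big_omega d + big_omega e"
    using pos by (simp add: big_omega_def e prime_factorization_mult)
  moreover have "big_omega e = card (prime_factors e)"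
    using arg_cong [OF prime_factorization_squarefree [OF sq], of size] by (simp add: big_omega_def)
  ultimately show ?thesis
    using sq e pos by (simp add: moebius_mu_def power_add power_mult)
qed

lemma sum_sign_big_omega:
  assumes "k > 0"
  shows "(\<Sum>d | sqfree_cofactor k dvd d \<and> d dvd k. (- 1) ^ big_omega (k * d) * f d)
    = (\<Sum>d | d dvd k. moebius_mu (k div d) * f d)"
proof (rule sum.mono_neutral_cong_left)
  show "finite {d. d dvd k}" using assms by simp
qed (use assms in \<open>auto simp: sqfree_cofactor_dvd_iff sign_big_omega_eq_moebius_mu moebius_mu_def\<close>)

text \<open>
  Compare with the product formula for \<open>totient k\<close>: a prime power \<open>q\<^sup>a\<close> exactly dividing \<open>k\<close> contributes
  \<open>q\<^sup>a\<close> divided by \<open>q\<close> to \<open>T(k)\<close>, and the primes dividing \<open>k / T(k)\<close> are those dividing \<open>k\<close>.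
\<close>
lemma totient_sqfree_cofactor:
  assumes "k > 0"
  shows "totient k = sqfree_cofactor k * (\<Prod>q | prime q \<and> q dvd k div sqfree_cofactor k. q - 1)"
proof -
  let ?P = "prime_factors k" and ?T = "sqfree_cofactor k"
  have T: "k = ?T * \<Prod>?P"
    using sqfree_cofactor_dvd [OF assms] by (metis dvd_mult_div_cancel)
  have k: "k = (\<Prod>p\<in>?P. p ^ multiplicity p k)"
    using assms by (rule prime_factorization_nat)
  also have "\<dots> = (\<Prod>p\<in>?P. p ^ (multiplicity p k - 1) * p)"
    by (intro prod.cong refl)
       (auto simp: prime_factors_multiplicity simp flip: power_Suc2)
  finally have "?T * \<Prod>?P = (\<Prod>p\<in>?P. p ^ (multiplicity p k - 1)) * \<Prod>?P"
    using T by (simp add: prod.distrib)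
  moreover have "\<Prod>?P \<noteq> 0" using T assms by (metis mult_0_right neq0_conv)
  \<comment> \<open>The radical of \<open>k\<close> has been cancelled from both sides.\<close>
  ultimately have "?T = (\<Prod>p\<in>?P. p ^ (multiplicity p k - 1))" by simp
  moreover have "{q. prime q \<and> q dvd k div ?T} = ?P"
  proof -
    have "q dvd k div ?T \<longleftrightarrow> q dvd k" if "prime q" for q
      using squarefree_dvd_sqfree_part_iff [OF assms, of q] squarefree_prime [OF that] by simp
    then show ?thesis using assms by (auto simp: prime_factors_dvd)
  qed
  ultimately show ?thesis
    using assms by (simp add: totient_formula1 prod.distrib)
qed

section \<open>Orbits of a cyclic action\<close>

text \<open>
  The differences \<open>i - j\<close> with \<open>h i = h j\<close> form a subgroup of the integers, nonzero because the
  range is finite. It is generated by its least positive element \<open>p\<close>, and \<open>h\<close> is a bijection from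
  the residues modulo \<open>p\<close> to the range, so that \<open>p\<close> is the number of values.
\<close>
lemma periodic_sequence_eq_iff:
  fixes h :: "int \<Rightarrow> 'b"
  assumes fin: "finite (range h)"
    and shift: "\<And>i j t. h i = h j \<Longrightarrow> h (i + t) = h (j + t)"
  shows "h i = h j \<longleftrightarrow> int (card (range h)) dvd i - j"
proof -
  have "\<not> inj h"
    using fin infinite_UNIV_int by (auto dest: finite_imageD)
  then obtain a b where ab: "h a = h b" "a \<noteq> b" by (auto simp: inj_def)
  have per: "h x = h y \<longleftrightarrow> h (x - y) = h 0" for x y
    using shift [of x y "- y"] shift [of "x - y" 0 y] by auto
  \<comment> \<open>A collision of \<open>h\<close> provides a positive period, so that a least one exists.\<close>
  let ?Q = "\<lambda>p. p > 0 \<and> h (int p) = h 0"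
  have "?Q (nat \<bar>a - b\<bar>)"
    using ab per [of a b] per [of b a] by (auto simp: abs_if)
  define p where "p = (LEAST p. ?Q p)"
  have p: "p > 0" "h (int p) = h 0"
    using LeastI [of ?Q, OF \<open>?Q (nat \<bar>a - b\<bar>)\<close>] by (auto simp: p_def)
  have mult: "h (int p * t) = h 0" for t
  proof (induction t rule: int_induct [where k = 0])
    case (step1 i)
    then show ?case using shift [of "int p * i" 0 "int p"] p by (simp add: algebra_simps)
  next
    case (step2 i)
    then show ?case using shift [of "int p" 0 "int p * i - int p"] p by (simp add: algebra_simps)
  qed simp
  have red: "h x = h (x mod int p)" for x
    using shift [OF mult, of "x div int p" "x mod int p"] by simp
  have zero: "h x = h 0 \<longleftrightarrow> int p dvd x" for x
  proof
    assume "h x = h 0"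
    then have "h (x mod int p) = h 0" using red by simp
    moreover have "x mod int p < int p" "x mod int p \<ge> 0" using p by simp_all
    ultimately have "\<not> ?Q (nat (x mod int p)) \<Longrightarrow> x mod int p = 0" by auto
    moreover have "\<not> ?Q (nat (x mod int p))"
      unfolding p_def by (rule not_less_Least) (use \<open>x mod int p < int p\<close> \<open>x mod int p \<ge> 0\<close> in \<open>simp add: p_def\<close>)
    ultimately show "int p dvd x" by auto
  next
    assume "int p dvd x"
    then show "h x = h 0" using mult by (auto elim: dvdE)
  qed
  have inj: "inj_on h {0..<int p}"
  proof (rule inj_onI)
    fix x y assume xy: "x \<in> {0..<int p}" "y \<in> {0..<int p}" "h x = h y"
    then have "int p dvd x - y" using per zero by blast
    then have "x mod int p = y mod int p" by (simp add: mod_eq_dvd_iff)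
    with xy show "x = y" by simp
  qed
  have "range h = h ` {0..<int p}"
  proof
    show "range h \<subseteq> h ` {0..<int p}"
    proof
      fix y assume "y \<in> range h"
      then obtain x where "y = h x" by blast
      then have "y = h (x mod int p)" using red by simp
      then show "y \<in> h ` {0..<int p}" using p by simp
    qed
  qed blast
  then have "card (range h) = p" using card_image [OF inj] by simp
  with per zero show ?thesis by simp
qed

text \<open>
  If \<open>h\<close> has exact period \<open>p\<close>, the progressions through \<open>i\<close> and \<open>j\<close> with step \<open>k\<close> take the same
  values iff \<open>i - j\<close> lies in the subgroup generated by \<open>k\<close> and \<open>p\<close>, which is that of the multiples
  of \<open>gcd k p\<close>. So they are parametrised by the residues modulo \<open>gcd k p\<close>.
\<close>
lemma card_progressions_of_periodic_sequence:
  fixes h :: "int \<Rightarrow> 'b"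
  assumes fin: "finite (range h)"
    and shift: "\<And>i j t. h i = h j \<Longrightarrow> h (i + t) = h (j + t)"
  shows "card (range (\<lambda>i. range (\<lambda>t. h (i + int k * t)))) = gcd k (card (range h))"
proof -
  define p where "p = card (range h)"
  define H where "H = (\<lambda>i. range (\<lambda>t. h (i + int k * t)))"
  define g where "g = gcd k p"
  have p: "p > 0" using fin by (simp add: p_def card_gt_0_iff)
  have g: "g > 0" using p by (simp add: g_def)
  have h_eq: "h i = h j \<longleftrightarrow> int p dvd i - j" for i j
    unfolding p_def using assms by (rule periodic_sequence_eq_iff)
  \<comment> \<open>By Bezout, \<open>i - j\<close> is a multiple of \<open>k\<close> plus a multiple of the period.\<close>
  have sub: "H i \<subseteq> H j" if "int g dvd i - j" for i j
  proof -
    obtain u v where "u * int k + v * int p = int g"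
      using bezout_int [of "int k" "int p"] by (auto simp: g_def)
    moreover obtain c where "i - j = int g * c" using \<open>int g dvd i - j\<close> by (rule dvdE)
    ultimately have ij: "i - j = c * u * int k + c * v * int p"
      by (metis distrib_left mult.assoc mult.commute)
    have "h (i + int k * t) \<in> H j" for t
    proof -
      have "(i + int k * t) - (j + int k * (t + c * u)) = c * v * int p"
        using ij by (simp add: algebra_simps)
      then have "h (i + int k * t) = h (j + int k * (t + c * u))"
        by (simp add: h_eq)
      then show ?thesis unfolding H_def by blast
    qed
    then show ?thesis by (auto simp: H_def)
  qed
  have H_eq: "H i = H j \<longleftrightarrow> int g dvd i - j" for i j
  proof
    assume "H i = H j"
    moreover have "h i \<in> H i" unfolding H_def by (rule range_eqI [of _ _ 0]) simp
    ultimately obtain t where "h i = h (j + int k * t)" unfolding H_def by blast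
    then have "int p dvd i - j - int k * t" by (simp add: h_eq algebra_simps)
    then have "int g dvd i - j - int k * t" by (rule dvd_trans [rotated]) (simp add: g_def)
    moreover have "int g dvd int k * t" by (simp add: g_def)
    ultimately have "int g dvd (i - j - int k * t) + int k * t" by (rule dvd_add)
    then show "int g dvd i - j" by simp
  next
    assume "int g dvd i - j"
    then show "H i = H j" using sub [of i j] sub [of j i] by (simp add: dvd_diff_commute)
  qed
  have inj: "inj_on H {0..<int g}"
  proof (rule inj_onI)
    fix x y assume xy: "x \<in> {0..<int g}" "y \<in> {0..<int g}" "H x = H y"
    then have "int g dvd x - y" by (simp add: H_eq)
    then have "x mod int g = y mod int g" by (simp only: mod_eq_dvd_iff)
    with xy(1,2) show "x = y" by simp
  qed
  have "range H = H ` {0..<int g}"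
  proof
    show "range H \<subseteq> H ` {0..<int g}"
    proof
      fix y assume "y \<in> range H"
      then obtain x where "y = H x" by blast
      then have "y = H (x mod int g)" by (simp add: H_eq)
      then show "y \<in> H ` {0..<int g}" using g by simp
    qed
  qed blast
  then show ?thesis using card_image [OF inj] by (simp add: H_def g_def p_def)
qed

text \<open>
  A generator \<open>g\<close> is fixed so that orbits, including those of the power subgroups, can be read as
  values of the sequence \<open>i \<mapsto> g\<^sup>i x\<close>. Exponents are integers rather than naturals: each orbit is
  then the range of a sequence on a group, and shifts in both directions are available.
\<close>
locale cyclic_action = group_action C S \<phi> + group C
  for C :: "('a, 'm) monoid_scheme" (structure) and S :: "'b set" and \<phi> :: "'a \<Rightarrow> 'b \<Rightarrow> 'b" +
  fixes g :: 'a
  assumes gen: "g \<in> carrier C" "carrier C = range (\<lambda>i::int. g [^] i)"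
    and finite_set: "finite S"
begin

lemma act_add:
  assumes "x \<in> S"
  shows "\<phi> (g [^] (i + j :: int)) x = \<phi> (g [^] i) (\<phi> (g [^] j) x)"
  using assms gen(1) by (simp add: int_pow_mult composition_rule)

lemma act_mem: "x \<in> S \<Longrightarrow> \<phi> (g [^] (i :: int)) x \<in> S"
  using element_image [OF int_pow_closed [OF gen(1)]] by blast

lemma orbit_eq: "orbit C \<phi> x = range (\<lambda>i::int. \<phi> (g [^] i) x)"
  unfolding orbit_def gen(2) by auto

lemma orbit_power_eq:
  "orbit (power_subgroup C k) \<phi> x = range (\<lambda>t::int. \<phi> (g [^] (int k * t)) x)"
proof -
  have pow: "(g [^] (i :: int)) [^] k = g [^] (int k * i)" for i
    using gen(1) int_pow_pow [of g i "int k"] by (simp add: int_pow_int mult.commute)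
  have "carrier (power_subgroup C k) = (\<lambda>c. c [^] k) ` carrier C"
    by (auto simp: power_subgroup_def)
  also have "\<dots> = range (\<lambda>t::int. g [^] (int k * t))"
    by (simp add: gen(2) image_image pow)
  finally have "carrier (power_subgroup C k) = range (\<lambda>t::int. g [^] (int k * t))" .
  then show ?thesis by (auto simp: orbit_def)
qed

lemma orbit_power_subset: "orbit (power_subgroup C k) \<phi> x \<subseteq> orbit C \<phi> x"
  by (auto simp: orbit_eq orbit_power_eq)

lemma orbit_power_refl:
  assumes "x \<in> S"
  shows "x \<in> orbit (power_subgroup C k) \<phi> x"
proof -
  have "\<phi> (g [^] (int k * 0)) x = x"
    using assms by (simp add: id_eq_one [symmetric])
  then show ?thesis unfolding orbit_power_eq by (metis rangeI)
qed

lemma orbit_subset: "x \<in> S \<Longrightarrow> orbit C \<phi> x \<subseteq> S"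
  by (auto simp: orbit_eq act_mem)

lemma finite_orbit: "x \<in> S \<Longrightarrow> finite (orbit C \<phi> x)"
  using orbit_subset finite_set finite_subset by blast

lemma finite_orbits: "finite (orbits C S \<phi>)"
  using finite_set by (simp add: orbits_def)

lemma card_orbit_pos: "X \<in> orbits C S \<phi> \<Longrightarrow> card X > 0"
  using finite_orbit orbit_refl by (force simp: orbits_def card_gt_0_iff)

lemma card_orbit_dvd_order: "X \<in> orbits C S \<phi> \<Longrightarrow> card X dvd order C"
  unfolding orbits_def by (auto simp flip: orbit_stabilizer_theorem)

lemma card_power_orbits_in_orbit:
  assumes "x \<in> S"
  shows "card (orbit (power_subgroup C k) \<phi> ` orbit C \<phi> x) = gcd k (card (orbit C \<phi> x))"
proof -
  define h where "h = (\<lambda>i::int. \<phi> (g [^] i) x)"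
  have orb: "orbit C \<phi> x = range h" by (simp add: orbit_eq h_def)
  have add: "h (t + i) = \<phi> (g [^] t) (h i)" for i t
    using assms by (simp add: h_def act_add)
  have "orbit (power_subgroup C k) \<phi> (h i) = range (\<lambda>t. h (i + int k * t))" for i
    by (simp add: orbit_power_eq add [symmetric] add.commute)
  then have img: "orbit (power_subgroup C k) \<phi> ` range h = range (\<lambda>i. range (\<lambda>t. h (i + int k * t)))"
    by (simp add: image_image)
  have shift: "h (i + t) = h (j + t)" if "h i = h j" for i j t
    using that add [of t i] add [of t j] by (simp add: add.commute)
  have fin: "finite (range h)" using finite_orbit [OF assms] orb by simp
  show ?thesis
    unfolding orb img by (rule card_progressions_of_periodic_sequence [OF fin]) (rule shift)
qed

text \<open>
  Every orbit of a power subgroup lies in a single \<open>C\<close>-orbit, so the count may be made in each \<open>C\<close>-orbit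
  separately.
\<close>
lemma num_orbits_power_eq_sum_gcd:
  "num_orbits_power C S \<phi> k = (\<Sum>X\<in>orbits C S \<phi>. gcd k (card X))"
proof -
  let ?O = "orbit (power_subgroup C k) \<phi>"
  have disj: "X = Y" if "X \<in> orbits C S \<phi>" "Y \<in> orbits C S \<phi>" "X \<inter> Y \<noteq> {}" for X Y
    using partition.disjoint_union [OF orbit_partition] that by blast
  have sub: "?O x \<subseteq> X" if "X \<in> orbits C S \<phi>" "x \<in> X" for x X
  proof -
    have "x \<in> S" using that orbit_subset by (auto simp: orbits_def)
    then have "X = orbit C \<phi> x"
      using disj [of X "orbit C \<phi> x"] that orbit_refl by (auto simp: orbits_def)
    then show ?thesis using orbit_power_subset by simp
  qed
  have mem: "x \<in> S" if "X \<in> orbits C S \<phi>" "x \<in> X" for x X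
    using that orbit_subset by (auto simp: orbits_def)
  have "S = \<Union>(orbits C S \<phi>)"
    using partition.partition_coverture [OF orbit_partition] by simp
  then have "orbits (power_subgroup C k) S \<phi> = (\<Union>X\<in>orbits C S \<phi>. ?O ` X)"
    by (auto simp: orbits_def [of "power_subgroup C k"])
  also have "card \<dots> = (\<Sum>X\<in>orbits C S \<phi>. card (?O ` X))"
  proof (rule card_UN_disjoint)
    show "\<forall>X\<in>orbits C S \<phi>. finite (?O ` X)"
      using finite_orbit by (auto simp: orbits_def)
    show "\<forall>X\<in>orbits C S \<phi>. \<forall>Y\<in>orbits C S \<phi>. X \<noteq> Y \<longrightarrow> ?O ` X \<inter> ?O ` Y = {}"
    proof (intro ballI impI, rule ccontr)
      fix X Y assume XY: "X \<in> orbits C S \<phi>" "Y \<in> orbits C S \<phi>" "X \<noteq> Y" "?O ` X \<inter> ?O ` Y \<noteq> {}"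
      then obtain x y where xy: "x \<in> X" "y \<in> Y" "?O x = ?O y" by auto
      then have "x \<in> Y"
        using sub [of Y y] orbit_power_refl [OF mem [of X x]] XY by auto
      with xy XY disj show False by blast
    qed
  qed (rule finite_orbits)
  also have "\<dots> = (\<Sum>X\<in>orbits C S \<phi>. gcd k (card X))"
    by (intro sum.cong refl) (auto simp: orbits_def card_power_orbits_in_orbit)
  finally show ?thesis by (simp add: num_orbits_power_def)
qed

lemma orbit_N_eq_card:
  assumes "k > 0"
  shows "orbit_N C S \<phi> k = of_nat (card {X \<in> orbits C S \<phi>. k dvd card X})"
proof -
  define T where "T = sqfree_cofactor k"
  define D where "D = (\<Prod>q | prime q \<and> q dvd k div T. q - 1)"
  let ?M = "num_orbits_power C S \<phi>" and ?c = "card {X \<in> orbits C S \<phi>. k dvd card X}"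
  have tot: "totient k = T * D"
    unfolding T_def D_def using assms by (rule totient_sqfree_cofactor)
  moreover have "totient k > 0" using assms by simp
  ultimately have pos: "T > 0" "D > 0" by simp_all
  \<comment> \<open>The signed sum is evaluated over the integers first; the rationals enter only for the
    division by \<open>T D = totient k\<close>.\<close>
  have "(\<Sum>d | T dvd d \<and> d dvd k. (- 1) ^ big_omega (k * d) * int (?M d))
      = (\<Sum>d | d dvd k. moebius_mu (k div d) * int (?M d))"
    unfolding T_def using assms by (rule sum_sign_big_omega)
  also have "\<dots> = (\<Sum>d | d dvd k. \<Sum>X\<in>orbits C S \<phi>. moebius_mu (k div d) * int (gcd d (card X)))"
    by (simp add: num_orbits_power_eq_sum_gcd sum_distrib_left)
  also have "\<dots> = (\<Sum>X\<in>orbits C S \<phi>. \<Sum>d | d dvd k. moebius_mu (k div d) * int (gcd d (card X)))"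
    by (rule sum.swap)
  also have "\<dots> = (\<Sum>X\<in>orbits C S \<phi>. if k dvd card X then int (totient k) else 0)"
    using assms by (simp only: sum_moebius_mu_gcd)
  also have "\<dots> = int (?c * (T * D))"
    using finite_orbits by (simp add: sum.If_cases tot Collect_conj_eq)
  finally have num: "(\<Sum>d | T dvd d \<and> d dvd k. (- 1) ^ big_omega (k * d) * int (?M d)) = int (?c * (T * D))" .
  have "(\<Sum>d | T dvd d \<and> d dvd k. (- 1) ^ big_omega (k * d) * rat_of_nat (?M d))
      = of_int (\<Sum>d | T dvd d \<and> d dvd k. (- 1) ^ big_omega (k * d) * int (?M d))"
    by simp
  also have "\<dots> = of_nat ?c * (of_nat T * of_nat D)"
    unfolding num by simp
  finally have "(\<Sum>d | T dvd d \<and> d dvd k. (- 1) ^ big_omega (k * d) * rat_of_nat (?M d))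
      = of_nat ?c * (of_nat T * of_nat D)" .
  moreover have "(\<Prod>q | prime q \<and> q dvd k div T. rat_of_nat q - 1) = of_nat D"
    unfolding D_def of_nat_prod by (intro prod.cong refl) (auto simp: of_nat_diff prime_ge_Suc_0_nat)
  ultimately show ?thesis
    using pos by (simp add: orbit_N_def T_def [symmetric])
qed

end

theorem theorem2p5:
  fixes C :: "('a, 'm) monoid_scheme" and S :: "'b set" and \<phi> :: "'a \<Rightarrow> 'b \<Rightarrow> 'b"
    and n m :: nat
  assumes "group C" and "cyclic_group C" and "finite (carrier C)" and "order C = n"
    and "group_action C S \<phi>" and "finite S"
    and "m dvd n"
  shows "(\<forall>k. k dvd n \<longrightarrow> orbit_N C S \<phi> k \<in> \<int>) \<and>
    of_nat (num_orbits_of_size C S \<phi> m) =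
      (\<Sum>d | d dvd n div m. of_int (moebius_mu d) * orbit_N C S \<phi> (m * d))"
proof -
  obtain g where g: "g \<in> carrier C" "carrier C = range (\<lambda>i::int. g [^]\<^bsub>C\<^esub> i)"
    using group.cyclic_group [OF assms(1)] assms(2) by blast
  interpret cyclic_action C S \<phi> g
    using assms g by (intro cyclic_action.intro cyclic_action_axioms.intro)
  have n: "n > 0" using assms(3,4) order_gt_0_iff_finite by blast
  have N: "orbit_N C S \<phi> k = of_int (\<Sum>X\<in>orbits C S \<phi>. if k dvd card X then 1 else 0)"
    if "k dvd n" for k
  proof -
    have "k > 0" using that n by (auto intro: Nat.gr0I)
    then show ?thesis
      using finite_orbits by (simp add: orbit_N_eq_card sum.If_cases Collect_conj_eq)
  qed
  have "(\<Sum>d | d dvd n div m. of_int (moebius_mu d) * orbit_N C S \<phi> (m * d))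
      = (\<Sum>d | d dvd n div m. of_int (\<Sum>X\<in>orbits C S \<phi>. if m * d dvd card X then moebius_mu d else 0))"
  proof (intro sum.cong refl)
    fix d assume "d \<in> {d. d dvd n div m}"
    then have "m * d dvd n" using assms(7) n
      by (metis dvd_mult_div_cancel mem_Collect_eq mult_dvd_mono dvd_refl)
    then show "of_int (moebius_mu d) * orbit_N C S \<phi> (m * d)
        = of_int (\<Sum>X\<in>orbits C S \<phi>. if m * d dvd card X then moebius_mu d else 0)"
      by (simp only: N of_int_mult [symmetric] sum_distrib_left if_distrib mult_1_right mult_zero_right)
  qed
  also have "\<dots> = of_int (\<Sum>X\<in>orbits C S \<phi>. \<Sum>d | d dvd n div m. if m * d dvd card X then moebius_mu d else 0)"
    by (subst sum.swap) simp
  also have "\<dots> = of_int (\<Sum>X\<in>orbits C S \<phi>. if card X = m then 1 else 0)"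
    using assms(4,7) n card_orbit_pos card_orbit_dvd_order
    by (intro arg_cong [where f = of_int] sum.cong refl sum_moebius_mu_dvd_both) auto
  also have "\<dots> = of_nat (num_orbits_of_size C S \<phi> m)"
    using finite_orbits by (simp add: num_orbits_of_size_def sum.If_cases Collect_conj_eq)
  finally show ?thesis using N by (auto intro: Ints_of_int)
qed

end
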